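(* For every integer $d\ge1$ there exists a minimal subshift $(X,\sigma)$ whose complexity satisfies $p_X(n)=\Theta(n^d)$ and such that $\mathrm{Aut}(X,\sigma)$ is isomorphic to $\mathbb Z^d$.
   Context: A subshift $(X,\sigma)$ is a closed shift-invariant subset $X\subseteq\mathcal A^{\mathbb Z}$ ($\mathcal A$ a finite alphabet) with the shift $\sigma((x_n)_n)=(x_{n+1})_n$; it is minimal if every orbit is dense. $p_X(n)$ is the number of words of length $n$ occurring in points of $X$. $f(n)=\Theta(g(n))$ means that there is a constant $K>0$ with $f(n)\le Kg(n)$ and $g(n)\le Kf(n)$ for all large enough $n$. $\mathrm{Aut}(X,\sigma)$ is the group of homeomorphisms of $X$ commuting with $\sigma$. *)

theory Defs
  imports "HOL-Analysis.Analysis" "HOL-Library.Landau_Symbols"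
    "HOL-Algebra.Bij" "HOL-Algebra.Product_Groups"
begin

text \<open>
  Alphabets are finite sets \<open>A\<close> of symbols of a type with the discrete topology. The type
  \<open>int \<Rightarrow> 'a\<close> then carries the product topology of discrete spaces, in which \<open>UNIV \<rightarrow> A\<close>
  is a closed subspace. Hence \<^const>\<open>closed\<close>, \<^const>\<open>closure\<close> and \<^const>\<open>homeomorphism\<close>
  of the ambient type have their usual meaning for subsets of the full shift over \<open>A\<close>.
\<close>

definition shift :: "(int \<Rightarrow> 'a) \<Rightarrow> int \<Rightarrow> 'a"
  where "shift x = (\<lambda>n. x (n + 1))"

definition subshift :: "'a::discrete_topology set \<Rightarrow> (int \<Rightarrow> 'a) set \<Rightarrow> bool"
  where "subshift A X \<longleftrightarrow> finite A \<and> X \<subseteq> UNIV \<rightarrow> A \<and> closed X \<and> shift ` X = X"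

text \<open>The two-sided orbit: \<open>\<lambda>n. x (n + k)\<close> is the \<open>k\<close>-th power of the shift applied to \<open>x\<close>,
  for any integer \<open>k\<close> (see \<open>orbit_funpow\<close> below).\<close>

definition orbit :: "(int \<Rightarrow> 'a) \<Rightarrow> (int \<Rightarrow> 'a) set"
  where "orbit x = {\<lambda>n. x (n + k) |k. True}"

definition minimal_shift :: "(int \<Rightarrow> 'a::discrete_topology) set \<Rightarrow> bool"
  where "minimal_shift X \<longleftrightarrow> (\<forall>x\<in>X. X \<subseteq> closure (orbit x))"

definition words :: "(int \<Rightarrow> 'a) set \<Rightarrow> nat \<Rightarrow> 'a list set"
  where "words X n = {map (\<lambda>i. x (k + int i)) [0..<n] |x k. x \<in> X}"

definition complexity :: "(int \<Rightarrow> 'a) set \<Rightarrow> nat \<Rightarrow> nat"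
  where "complexity X n = card (words X n)"

text \<open>As in \<^const>\<open>BijGroup\<close>, self-maps of \<open>X\<close> are represented by functions that are
  extensional on \<open>X\<close>, so that each self-map has a unique representative.\<close>

definition shift_auts :: "(int \<Rightarrow> 'a::discrete_topology) set \<Rightarrow> ((int \<Rightarrow> 'a) \<Rightarrow> int \<Rightarrow> 'a) set"
  where "shift_auts X = {f \<in> extensional X.
    (\<exists>g. homeomorphism X X f g) \<and> (\<forall>x\<in>X. f (shift x) = shift (f x))}"

definition Aut :: "(int \<Rightarrow> 'a::discrete_topology) set \<Rightarrow> ((int \<Rightarrow> 'a) \<Rightarrow> int \<Rightarrow> 'a) monoid"
  where "Aut X = BijGroup X \<lparr>carrier := shift_auts X\<rparr>"

definition int_power_group :: "nat \<Rightarrow> (nat \<Rightarrow> int) monoid"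
  where "int_power_group d = product_group {..<d} (\<lambda>_. integer_group)"

lemma funpow_shift: "(shift ^^ k) x = (\<lambda>n. x (n + int k))"
  by (induction k) (auto simp: shift_def algebra_simps)

lemma orbit_funpow:
  "orbit x = {y. \<exists>k. y = (shift ^^ k) x \<or> (shift ^^ k) y = x}" (is "_ = ?R")
proof (intro equalityI subsetI)
  fix y assume "y \<in> orbit x"
  then obtain k where k: "y = (\<lambda>n. x (n + k))" by (auto simp: orbit_def)
  show "y \<in> ?R"
  proof (cases "k \<ge> 0")
    case True
    then have "y = (shift ^^ nat k) x" by (simp add: funpow_shift k)
    then show ?thesis by blast
  next
    case False
    then have "(shift ^^ nat (- k)) y = x" by (simp add: funpow_shift k)
    then show ?thesis by blast
  qed
next
  fix y assume "y \<in> ?R"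
  then obtain k where "y = (shift ^^ k) x \<or> (shift ^^ k) y = x" by blast
  then show "y \<in> orbit x"
  proof
    assume "y = (shift ^^ k) x"
    then show ?thesis by (auto simp: funpow_shift orbit_def)
  next
    assume "(shift ^^ k) y = x"
    then have "y = (\<lambda>n. x (n + - int k))" by (auto simp: funpow_shift)
    then show ?thesis unfolding orbit_def by blast
  qed
qed

lemma shift_auts_Bij: "shift_auts X \<subseteq> Bij X"
  by (auto simp: shift_auts_def Bij_def homeomorphism_def intro!: bij_betw_byWitness)

lemma subgroup_shift_auts:
  assumes X: "shift ` X = X"
  shows "subgroup (shift_auts X) (BijGroup X)"
proof (rule subgroup.intro)
  show "shift_auts X \<subseteq> carrier (BijGroup X)"
    using shift_auts_Bij by (auto simp: BijGroup_def)
next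
  fix f f' assume f: "f \<in> shift_auts X" and f': "f' \<in> shift_auts X"
  obtain g g' where g: "homeomorphism X X f g" and g': "homeomorphism X X f' g'"
    using f f' by (auto simp: shift_auts_def)
  have "homeomorphism X X (f \<circ> f') (g' \<circ> g)"
    using homeomorphism_compose[OF g' g] .
  then have "homeomorphism X X (compose X f f') (g' \<circ> g)"
    by (rule homeomorphism_cong) (auto simp: compose_def)
  moreover have "compose X f f' (shift x) = shift (compose X f f' x)" if "x \<in> X" for x
  proof -
    have "shift x \<in> X" "f' x \<in> X" using that X g' by (auto simp: homeomorphism_def)
    then show ?thesis using f f' that by (simp add: compose_def shift_auts_def)
  qed
  ultimately have "compose X f f' \<in> shift_auts X"
    by (auto simp: shift_auts_def)
  moreover have "f \<in> Bij X" "f' \<in> Bij X" using f f' shift_auts_Bij by auto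
  ultimately show "f \<otimes>\<^bsub>BijGroup X\<^esub> f' \<in> shift_auts X"
    by (simp add: BijGroup_def)
next
  have "homeomorphism X X (\<lambda>x\<in>X. x) (\<lambda>x. x)"
    by (rule homeomorphism_cong[OF homeomorphism_ident]) auto
  then show "\<one>\<^bsub>BijGroup X\<^esub> \<in> shift_auts X"
    using X by (auto simp: BijGroup_def shift_auts_def)
next
  fix f assume f: "f \<in> shift_auts X"
  then obtain g where g: "homeomorphism X X f g" by (auto simp: shift_auts_def)
  have fB: "f \<in> Bij X" using f shift_auts_Bij by blast
  have inv: "inv_into X f x = g x" if "x \<in> X" for x
  proof -
    have "inj_on f X" using fB by (auto simp: Bij_def bij_betw_def)
    then show ?thesis using g that
      by (metis homeomorphism_def imageI inv_into_f_f)
  qed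
  have eq: "m_inv (BijGroup X) f = (\<lambda>x\<in>X. g x)"
    using inv_BijGroup[OF fB] inv by (auto simp: restrict_def)
  have "homeomorphism X X (\<lambda>x\<in>X. g x) f"
    by (rule homeomorphism_cong[OF homeomorphism_symD[OF g]]) auto
  moreover have "g (shift x) = shift (g x)" if "x \<in> X" for x
  proof -
    have "g x \<in> X" using g that by (auto simp: homeomorphism_def)
    then have "f (shift (g x)) = shift x" "shift (g x) \<in> X"
      using f g that X by (auto simp: shift_auts_def homeomorphism_def)
    then show ?thesis using g by (metis homeomorphism_def)
  qed
  ultimately show "m_inv (BijGroup X) f \<in> shift_auts X"
    using X by (auto simp: eq shift_auts_def)
qed

lemma group_Aut:
  assumes "subshift A X"
  shows "group (Aut X)"
  unfolding Aut_def
  using group.subgroup_imp_group[OF group_BijGroup subgroup_shift_auts] assms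
  by (auto simp: subshift_def)

end

theory Submission
  imports Defs "HOL-Number_Theory.Cong"
begin

text \<open>
  For \<open>p \<ge> 2\<close> the sequences \<open>n \<mapsto> v\<^sub>p(n + t) mod 2\<close> with \<open>t\<close> a \<open>p\<close>-adic integer, completed by an
  arbitrary value at \<open>n = - t\<close> when \<open>t\<close> is an integer, form a minimal Toeplitz subshift. A window
  of length \<open>n\<close> determines \<open>t\<close> modulo a power of \<open>p\<close> comparable to \<open>n\<close>, and conversely such a
  residue determines the window up to one symbol, so its complexity is \<open>\<Theta>(n)\<close>. The example is the
  product of \<open>d\<close> of these for distinct primes, which is minimal by the Chinese remainder theorem.

  The points with all \<open>t\<^sub>i = 0\<close> form a set of \<open>2 ^ d\<close> pairwise asymptotic points. An automorphism
  \<open>f\<close>, being a sliding block code, maps it injectively into an asymptotic class, and a class of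
  that size requires every coordinate of its residue to be an integer \<open>k\<^sub>i\<close>. Then \<open>f\<close> agrees with
  the translation by \<open>k\<close> far from the origin on one point, hence everywhere by recurrence.
\<close>

section \<open>Toeplitz sequences\<close>

text \<open>The integer \<open>t\<close> stands for its residue class modulo \<open>p ^ m\<close>.
  The bits on the class of \<open>- t\<close> are left free, so the condition is a
  level-\<open>m\<close> approximation of the sequence attached to a \<open>p\<close>-adic
  integer.\<close>

definition toeplitz :: "int \<Rightarrow> nat \<Rightarrow> (int \<Rightarrow> bool) \<Rightarrow> int \<Rightarrow> bool"
  where "toeplitz p m b t \<longleftrightarrow> (\<forall>n. \<not> p ^ m dvd n + t \<longrightarrow> b n = odd (multiplicity p (n + t)))"

lemma toeplitzD: "toeplitz p m b t \<Longrightarrow> \<not> p ^ m dvd n + t \<Longrightarrow> b n = odd (multiplicity p (n + t))"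
  by (simp add: toeplitz_def)

text \<open>The valuation \<open>v\<close> of \<open>a\<close> is below \<open>m\<close>, so
  \<open>p ^ v\<close> and \<open>p ^ Suc v\<close> both divide \<open>p ^ m\<close>, and whether
  they divide a number depends only on its class modulo \<open>p ^ m\<close>.\<close>

lemma multiplicity_cong_power:
  fixes p :: int
  assumes p: "p \<ge> 2" and a: "\<not> p ^ m dvd a" and ab: "p ^ m dvd a - b"
  shows "multiplicity p a = multiplicity p b"
proof -
  define v where "v = multiplicity p a"
  have a0: "a \<noteq> 0" and up: "\<not> is_unit p" using a p by (auto simp: zdvd_not_zless)
  have v: "p ^ v dvd a" by (simp add: v_def multiplicity_dvd)
  have Sv: "\<not> p ^ Suc v dvd a"
    using power_dvd_iff_le_multiplicity[OF a0 up, of "Suc v"] by (simp add: v_def)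
  have "Suc v \<le> m"
    using power_dvd_iff_le_multiplicity[OF a0 up, of m] a by (simp add: v_def)
  then have "p ^ Suc v dvd a - b" using ab le_imp_power_dvd dvd_trans by blast
  moreover have "a = b + (a - b)" by simp
  ultimately have "\<not> p ^ Suc v dvd b" using Sv by (metis dvd_add)
  moreover have "p ^ v dvd a - b"
    using dvd_trans[OF le_imp_power_dvd[of v "Suc v" p] \<open>p ^ Suc v dvd a - b\<close>] by simp
  from dvd_diff[OF v this] have "p ^ v dvd b" by simp
  ultimately have "multiplicity p b = v" by (intro multiplicity_eqI)
  then show ?thesis by (simp add: v_def)
qed

lemma toeplitz_cong:
  assumes p: "p \<ge> 2" and ts: "p ^ m dvd t - s" and t: "toeplitz p m b t"
  shows "toeplitz p m b s"
  unfolding toeplitz_def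
proof (intro allI impI)
  fix n assume n: "\<not> p ^ m dvd n + s"
  have "n + t = (n + s) + (t - s)" by simp
  then have "\<not> p ^ m dvd n + t" using n ts by (metis dvd_add_left_iff)
  moreover have "p ^ m dvd (n + t) - (n + s)" using ts by simp
  ultimately show "b n = odd (multiplicity p (n + s))"
    using toeplitzD[OF t] multiplicity_cong_power[OF p] by metis
qed

lemma toeplitz_mono:
  assumes "m \<le> m'" "toeplitz p m' b t" shows "toeplitz p m b t"
  unfolding toeplitz_def
proof (intro allI impI)
  fix n assume "\<not> p ^ m dvd n + t"
  then have "\<not> p ^ m' dvd n + t" using dvd_trans[OF le_imp_power_dvd[OF assms(1)]] by auto
  then show "b n = odd (multiplicity p (n + t))" by (rule toeplitzD[OF assms(2)])
qed

lemma toeplitz_translate: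
  "toeplitz p m (\<lambda>n. b (n + k)) t \<longleftrightarrow> toeplitz p m b (t - k)"
proof -
  have "(\<forall>n. P (n + k)) \<longleftrightarrow> (\<forall>n. P n)" for P :: "int \<Rightarrow> bool"
    by (metis diff_add_cancel)
  from this[of "\<lambda>n. \<not> p ^ m dvd n + (t - k) \<longrightarrow> b n = odd (multiplicity p (n + (t - k)))"]
  show ?thesis by (simp add: toeplitz_def)
qed

text \<open>If \<open>v\<close> is the valuation of \<open>t - s\<close>, the window contains an \<open>n\<close> such that \<open>n + t\<close> has
  valuation \<open>v + 1\<close>; then \<open>n + s\<close> has valuation \<open>v\<close>, of the opposite parity.\<close>

lemma toeplitz_residue_unique:
  assumes p: "p \<ge> 2" and t: "toeplitz p (Suc m) b t" and s: "toeplitz p (Suc m) c s"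
    and bc: "\<And>n. a \<le> n \<Longrightarrow> n < a + p ^ Suc m \<Longrightarrow> b n = c n"
  shows "p ^ m dvd t - s"
proof (rule ccontr)
  assume nd: "\<not> p ^ m dvd t - s"
  define v where "v = multiplicity p (t - s)"
  have ts0: "t - s \<noteq> 0" and up: "\<not> is_unit p" using nd p by (auto simp: zdvd_not_zless)
  have v: "p ^ v dvd t - s" by (simp add: v_def multiplicity_dvd)
  have Sv: "\<not> p ^ Suc v dvd t - s"
    using power_dvd_iff_le_multiplicity[OF ts0 up, of "Suc v"] by (simp add: v_def)
  have vm: "Suc v \<le> m"
    using power_dvd_iff_le_multiplicity[OF ts0 up, of m] nd by (simp add: v_def)
  \<comment> \<open>This is the first position from \<open>a\<close> on with \<open>n + t\<close>
    congruent to \<open>p ^ Suc v\<close> modulo \<open>p ^ Suc (Suc v)\<close>. It lies in the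
    window because \<open>Suc v \<le> m\<close>.\<close>
  define n where "n = a + (p ^ Suc v - t - a) mod p ^ Suc (Suc v)"
  have pos: "0 < p ^ k" for k using p by simp
  have n1: "a \<le> n" "n < a + p ^ Suc (Suc v)"
    unfolding n_def using pos_mod_sign[OF pos[of "Suc (Suc v)"], of "p ^ Suc v - t - a"]
      pos_mod_bound[OF pos[of "Suc (Suc v)"], of "p ^ Suc v - t - a"] by linarith+
  have "p ^ Suc (Suc v) \<le> p ^ Suc m" using vm p by (intro power_increasing) auto
  then have bcn: "b n = c n" using n1 by (intro bc) auto
  have "p ^ Suc (Suc v) dvd (p ^ Suc v - t - a) mod p ^ Suc (Suc v) - (p ^ Suc v - t - a)"
    by (simp add: mod_eq_dvd_iff[symmetric])
  then have n2: "p ^ Suc (Suc v) dvd (n + t) - p ^ Suc v"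
    by (simp add: n_def algebra_simps)
  have nlt: "\<not> p ^ Suc (Suc v) dvd p ^ Suc v"
    using p by (intro zdvd_not_zless) auto
  have d1: "p ^ Suc v dvd n + t"
    using dvd_add[OF dvd_trans[OF le_imp_power_dvd n2, of "Suc v"] dvd_refl[of "p ^ Suc v"]] by simp
  have d2: "\<not> p ^ Suc (Suc v) dvd n + t"
  proof
    assume "p ^ Suc (Suc v) dvd n + t"
    from dvd_diff[OF this n2] nlt show False by simp
  qed
  have d3: "p ^ v dvd n + s" 
  proof -
    have "p ^ v dvd n + t" using dvd_trans[OF le_imp_power_dvd d1, of v] by simp
    then have "p ^ v dvd (n + t) - (t - s)" using v by (rule dvd_diff)
    then show ?thesis by simp
  qed
  have d4: "\<not> p ^ Suc v dvd n + s"
  proof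
    assume "p ^ Suc v dvd n + s"
    then have "p ^ Suc v dvd (n + t) - (n + s)" using d1 by (intro dvd_diff)
    with Sv show False by simp
  qed
  have m1: "multiplicity p (n + t) = Suc v" "multiplicity p (n + s) = v"
    using d1 d2 d3 d4 by (auto intro!: multiplicity_eqI)
  have "\<not> p ^ Suc m dvd n + t" "\<not> p ^ Suc m dvd n + s"
    using d2 d4 vm dvd_trans[OF le_imp_power_dvd, of "Suc (Suc v)" "Suc m" p "n + t"]
      dvd_trans[OF le_imp_power_dvd, of "Suc v" "Suc m" p "n + s"] by auto
  then have "b n = odd (Suc v)" "c n = odd v"
    using toeplitzD[OF t, of n] toeplitzD[OF s, of n] m1 by auto
  then show False using bcn by simp
qed

text \<open>By uniqueness on windows \<open>t - s\<close> is divisible by every power of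
  \<open>p\<close>, hence zero. So an integer residue, and with it the position of the hole, is
  determined by the sequence.\<close>

lemma toeplitz_integer_residue_unique:
  assumes p: "p \<ge> 2" and "\<And>m. toeplitz p m b t" "\<And>m. toeplitz p m b s"
  shows "t = s"
proof (rule ccontr)
  assume "t \<noteq> s"
  have "p ^ m dvd t - s" for m
    using toeplitz_residue_unique[OF p] assms(2,3) by blast
  moreover have "\<not> is_unit p" using p by (auto simp: zdvd_not_zless)
  ultimately have "n \<le> multiplicity p (t - s)" for n
    using \<open>t \<noteq> s\<close> power_dvd_iff_le_multiplicity[of "t - s" p n] by simp
  then show False using not_less_eq_eq by blast
qed

section \<open>Cylinders and sliding block codes\<close>

lemma open_cylinder:
  fixes x :: "int \<Rightarrow> 'a::discrete_topology"
  shows "open {y. \<forall>n\<in>{-N..N}. y n = x n}"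
proof -
  have "{y. \<forall>n\<in>{-N..N}. y n = x n} = (\<Inter>n\<in>{-N..N}. (\<lambda>y. y n) -` {x n})" by auto
  moreover have "open ((\<lambda>y :: int \<Rightarrow> 'a. y n) -` {x n})" for n
    by (intro open_vimage open_discrete) auto
  ultimately show ?thesis by auto
qed

text \<open>A basic open set of the product restricts only finitely many coordinates, and these lie
  in a common symmetric window.\<close>

lemma open_contains_cylinder:
  fixes U :: "(int \<Rightarrow> 'a::discrete_topology) set"
  assumes "open U" "x \<in> U"
  obtains N where "\<And>y. (\<And>n. n \<in> {-N..N} \<Longrightarrow> y n = x n) \<Longrightarrow> y \<in> U"
proof -
  have U: "openin (product_topology (\<lambda>_::int. euclidean :: 'a topology) UNIV) U"
    using assms(1) by (simp only: euclidean_product_topology open_openin[symmetric])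
  have "\<exists>B. x \<in> PiE UNIV B \<and> (\<forall>i. openin euclidean (B i)) \<and>
      finite {i. B i \<noteq> topspace euclidean} \<and> PiE UNIV B \<subseteq> U"
    using product_topology_open_contains_basis[OF U assms(2)] .
  then obtain B where "x \<in> PiE UNIV B \<and> (\<forall>i. openin euclidean (B i)) \<and>
      finite {i. B i \<noteq> topspace euclidean} \<and> PiE UNIV B \<subseteq> U" by (rule exE)
  then have B: "x \<in> PiE UNIV B" "finite {i. B i \<noteq> UNIV}" "PiE UNIV B \<subseteq> U"
    by simp_all
  define N where "N = Max (insert 0 (abs ` {i. B i \<noteq> UNIV}))"
  have N: "\<bar>i\<bar> \<le> N" if "B i \<noteq> UNIV" for i
    unfolding N_def using B(2) that by (intro Max_ge) auto
  show ?thesis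
  proof (rule that)
    fix y assume y: "\<And>n. n \<in> {-N..N} \<Longrightarrow> y n = x n"
    have "y i \<in> B i" for i
    proof (cases "B i = UNIV")
      case False
      then have "y i = x i" using N[OF False] by (intro y) auto
      then show ?thesis using PiE_mem[OF B(1), of i] by simp
    qed simp
    then have "y \<in> PiE UNIV B" by (simp add: PiE_UNIV_domain)
    then show "y \<in> U" by (rule subsetD[OF B(3)])
  qed
qed

lemma continuous_on_sliding:
  fixes f :: "(int \<Rightarrow> 'a::discrete_topology) \<Rightarrow> int \<Rightarrow> 'a"
  assumes "\<And>n. \<exists>N. \<forall>x y. (\<forall>i\<in>{-N..N}. y i = x i) \<longrightarrow> f y n = f x n"
  shows "continuous_on X f"
proof (rule continuous_on_coordinatewise_then_product)
  fix n
  obtain N where N: "\<And>x y. \<forall>i\<in>{-N..N}. y i = x i \<Longrightarrow> f y n = f x n"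
    using assms[of n] by blast
  have "open ((\<lambda>x. f x n) -` S)" for S
  proof (subst open_subopen, safe)
    fix x assume "f x n \<in> S"
    then show "\<exists>T. open T \<and> x \<in> T \<and> T \<subseteq> (\<lambda>x. f x n) -` S"
      by (intro exI[of _ "{y. \<forall>i\<in>{-N..N}. y i = x i}"] conjI open_cylinder) (auto dest: N)
  qed
  then have "continuous_on UNIV (\<lambda>x. f x n)"
    by (simp add: continuous_on_open_vimage[OF open_UNIV])
  then show "continuous_on X (\<lambda>x. f x n)" by (rule continuous_on_subset) simp
qed

lemma compact_subshift:
  assumes "subshift A X" shows "compact X"
proof -
  have A: "finite A" "X \<subseteq> UNIV \<rightarrow> A" "closed X" using assms by (auto simp: subshift_def)
  have "compactin (product_topology (\<lambda>_::int. euclidean) UNIV) (PiE UNIV (\<lambda>_. A))"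
    by (subst compactin_PiE) (simp add: A(1) finite_imp_compact)
  then have "compact (PiE UNIV (\<lambda>_::int. A))"
    by (simp add: euclidean_product_topology)
  then have "compact (X \<inter> PiE UNIV (\<lambda>_. A))" using A(3) by (intro closed_Int_compact)
  moreover have "X \<inter> PiE UNIV (\<lambda>_. A) = X" using A(2) by auto
  ultimately show ?thesis by simp
qed

lemma translate_commute:
  assumes X: "shift ` X = X" and com: "\<And>x. x \<in> X \<Longrightarrow> f (shift x) = shift (f x)" and x: "x \<in> X"
  shows "(\<lambda>n. x (n + k)) \<in> X \<and> f (\<lambda>n. x (n + k)) = (\<lambda>n. f x (n + k))"
proof -
  have pos: "(shift ^^ j) y \<in> X \<and> f ((shift ^^ j) y) = (shift ^^ j) (f y)" if "y \<in> X" for y j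
    using that X com by (induction j) auto
  show ?thesis
  proof (cases "k \<ge> 0")
    case True
    then show ?thesis using pos[OF x, of "nat k"] by (simp add: funpow_shift)
  next
    case False
    \<comment> \<open>For negative \<open>k\<close>, surjectivity of the shift on \<open>X\<close>
      supplies a point of \<open>X\<close> that a power of the shift sends to \<open>x\<close>; this
      point is the wanted translate.\<close>
    have "\<exists>y\<in>X. (shift ^^ j) y = x" for j
    proof (induction j)
      case (Suc j)
      then obtain y where y: "y \<in> X" "(shift ^^ j) y = x" by blast
      then obtain z where "z \<in> X" "shift z = y" using X by (metis imageE)
      with y show ?case by (auto simp: funpow_Suc_right simp del: funpow.simps)
    qed (use x in auto)
    then obtain y where y: "y \<in> X" "(shift ^^ nat (- k)) y = x" by blast
    then have "y = (\<lambda>n. x (n + k))" using False by (auto simp: funpow_shift)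
    moreover have "f x = (shift ^^ nat (- k)) (f y)" using pos y by metis
    then have "(\<lambda>n. f x (n + k)) = f y" using False by (simp add: funpow_shift)
    ultimately show ?thesis using y(1) by simp
  qed
qed

text \<open>This is the Curtis-Hedlund-Lyndon theorem. The symbol \<open>f x 0\<close> is locally
  constant in \<open>x\<close>, compactness makes the radius uniform, and commutation with the shift
  carries it from position 0 to every \<open>k\<close>.\<close>

lemma sliding_block_code:
  fixes f :: "(int \<Rightarrow> 'a::discrete_topology) \<Rightarrow> int \<Rightarrow> 'a"
  assumes X: "subshift A X" and f: "continuous_on X f"
    and com: "\<And>x. x \<in> X \<Longrightarrow> f (shift x) = shift (f x)"
  obtains R where "R \<ge> 0"
    "\<And>x y k. x \<in> X \<Longrightarrow> y \<in> X \<Longrightarrow> (\<And>n. n \<in> {k - R..k + R} \<Longrightarrow> x n = y n) \<Longrightarrow> f x k = f y k"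
proof -
  let ?C = "\<lambda>N x. {y. \<forall>n\<in>{-N..N}. y n = x n} :: (int \<Rightarrow> 'a) set"
  have "\<exists>N. \<forall>y\<in>X \<inter> ?C N x. f y 0 = f x 0" if x: "x \<in> X" for x
  proof -
    have "continuous_on X (\<lambda>x. f x 0)" using f by (rule continuous_on_product_then_coordinatewise)
    then obtain U where U: "open U" "U \<inter> X = (\<lambda>x. f x 0) -` {f x 0} \<inter> X"
      unfolding continuous_on_open_invariant using open_discrete by metis
    have "x \<in> U" using U x by auto
    from open_contains_cylinder[OF U(1) this] obtain N where
      "\<And>y. (\<And>n. n \<in> {-N..N} \<Longrightarrow> y n = x n) \<Longrightarrow> y \<in> U" by blast
    then have "?C N x \<subseteq> U" by blast
    then show ?thesis using U(2) by blast
  qed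
  then have "\<forall>x\<in>X. \<exists>N. \<forall>y\<in>X \<inter> ?C N x. f y 0 = f x 0" by blast
  from bchoice[OF this] obtain N
    where N: "\<And>x y. x \<in> X \<Longrightarrow> y \<in> X \<Longrightarrow> y \<in> ?C (N x) x \<Longrightarrow> f y 0 = f x 0" by blast
  have "X \<subseteq> (\<Union>x\<in>X. ?C (N x) x)" by auto
  then obtain S where S: "S \<subseteq> X" "finite S" "X \<subseteq> (\<Union>x\<in>S. ?C (N x) x)"
    by (rule compactE_image[OF compact_subshift[OF X] open_cylinder])
  define R where "R = Max (insert 0 (N ` S))"
  have R: "R \<ge> 0" "\<And>z. z \<in> S \<Longrightarrow> N z \<le> R" using S(2) by (auto simp: R_def)
  have base: "f x 0 = f y 0" if xy: "x \<in> X" "y \<in> X" "\<And>n. n \<in> {-R..R} \<Longrightarrow> x n = y n" for x y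
  proof -
    \<comment> \<open>Since \<open>N z \<le> R\<close>, both \<open>x\<close> and \<open>y\<close>
      lie in the cylinder around the centre \<open>z\<close>, so both values at 0 equal
      \<open>f z 0\<close>.\<close>
    obtain z where z: "z \<in> S" "x \<in> ?C (N z) z" using S(3) xy(1) by blast
    have "y n = z n" if "n \<in> {- N z..N z}" for n
      using that xy(3)[of n] R(2)[OF z(1)] z(2) by auto
    then have "y \<in> ?C (N z) z" by blast
    then show ?thesis using N[of z x] N[of z y] z S(1) xy by auto
  qed
  have sX: "shift ` X = X" using X by (simp add: subshift_def)
  have tr: "(\<lambda>n. x (n + k)) \<in> X \<and> f (\<lambda>n. x (n + k)) = (\<lambda>n. f x (n + k))" if "x \<in> X" for x k
    by (rule translate_commute) (use sX com that in auto)
  show ?thesis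
  proof (rule that[OF R(1)])
    fix x y k assume xy: "x \<in> X" "y \<in> X" and eq: "\<And>n. n \<in> {k - R..k + R} \<Longrightarrow> x n = y n"
    have "f (\<lambda>n. x (n + k)) 0 = f (\<lambda>n. y (n + k)) 0"
      using tr xy eq by (intro base) auto
    then show "f x k = f y k" using tr xy by simp
  qed
qed

section \<open>Products of Toeplitz subshifts\<close>

text \<open>Binary coding packs \<open>d\<close> bits into one natural number, so a single sequence
  carries \<open>d\<close> Boolean layers.\<close>

definition symbols :: "nat \<Rightarrow> nat set"
  where "symbols d = set_encode ` Pow {..<d}"

definition layer :: "(int \<Rightarrow> nat) \<Rightarrow> nat \<Rightarrow> int \<Rightarrow> bool"
  where "layer x i n \<longleftrightarrow> i \<in> set_decode (x n)"

definition stack :: "nat \<Rightarrow> (nat \<Rightarrow> int \<Rightarrow> bool) \<Rightarrow> int \<Rightarrow> nat"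
  where "stack d \<beta> n = set_encode {i. i < d \<and> \<beta> i n}"

lemma finite_symbols: "finite (symbols d)"
  by (simp add: symbols_def)

lemma stack_in_symbols: "stack d \<beta> n \<in> symbols d"
  by (auto simp: symbols_def stack_def)

lemma layer_stack: "layer (stack d \<beta>) i n \<longleftrightarrow> i < d \<and> \<beta> i n"
  by (simp add: layer_def stack_def)

lemma layer_stack_fun: "i < d \<Longrightarrow> layer (stack d \<beta>) i = \<beta> i"
  by (simp add: layer_stack fun_eq_iff)

lemma symbol_eqI:
  assumes "x n \<in> symbols d" "y m \<in> symbols d" "\<And>i. i < d \<Longrightarrow> layer x i n = layer y i m"
  shows "x n = y m"
proof -
  obtain S T where ST: "S \<subseteq> {..<d}" "x n = set_encode S" "T \<subseteq> {..<d}" "y m = set_encode T"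
    using assms(1,2) by (auto simp: symbols_def)
  have "finite S" "finite T" using ST(1,3) finite_subset by auto
  then have "S = T" using assms(3) ST by (auto simp: layer_def)
  then show ?thesis using ST by simp
qed

locale toeplitz_product =
  fixes d :: nat and p :: "nat \<Rightarrow> nat"
  assumes p_ge: "i < d \<Longrightarrow> 2 \<le> p i"
    and p_coprime: "i < d \<Longrightarrow> j < d \<Longrightarrow> i \<noteq> j \<Longrightarrow> coprime (p i) (p j)"
begin

text \<open>The residues \<open>t\<close> for different \<open>m\<close> are compatible by uniqueness, so they form
  a \<open>p i\<close>-adic integer. If it is an ordinary integer, the layer has a hole at \<open>- t\<close>, where both
  values are allowed.\<close>

definition X :: "(int \<Rightarrow> nat) set"
  where "X = {x \<in> UNIV \<rightarrow> symbols d. \<forall>i<d. \<forall>m. \<exists>t. toeplitz (int (p i)) m (layer x i) t}"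

text \<open>Each layer moves by its own amount, which gives an action of the group of integer
  vectors of length \<open>d\<close>; the shift is the vector with all entries 1.\<close>

definition translate :: "(nat \<Rightarrow> int) \<Rightarrow> (int \<Rightarrow> nat) \<Rightarrow> int \<Rightarrow> nat"
  where "translate k x = stack d (\<lambda>i n. layer x i (n + k i))"

text \<open>Where \<open>n + t i = 0\<close> the bit is \<open>False\<close>, because \<open>multiplicity p 0 = 0\<close>.\<close>

definition point :: "(nat \<Rightarrow> int) \<Rightarrow> int \<Rightarrow> nat"
  where "point t = stack d (\<lambda>i n. odd (multiplicity (int (p i)) (n + t i)))"

lemma int_p_ge: "i < d \<Longrightarrow> 2 \<le> int (p i)"
  using p_ge[of i] by simp

lemma X_symbol: "x \<in> X \<Longrightarrow> x n \<in> symbols d"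
  by (auto simp: X_def)

lemma X_residue: "x \<in> X \<Longrightarrow> i < d \<Longrightarrow> \<exists>t. toeplitz (int (p i)) m (layer x i) t"
  by (simp add: X_def)

lemma X_eqI:
  "x \<in> X \<Longrightarrow> y \<in> X \<Longrightarrow> (\<And>i. i < d \<Longrightarrow> layer x i n = layer y i m) \<Longrightarrow> x n = y m"
  by (rule symbol_eqI[where d = d]) (auto simp: X_symbol)

lemma layer_translate: "i < d \<Longrightarrow> layer (translate k x) i n = layer x i (n + k i)"
  by (simp add: translate_def layer_stack)

lemma translate_in_X: "x \<in> X \<Longrightarrow> translate k x \<in> X"
  unfolding X_def
proof (clarsimp, intro conjI allI impI)
  show "translate k x \<in> UNIV \<rightarrow> symbols d" by (auto simp: translate_def stack_in_symbols)
next
  fix i m assume i: "i < d" and x: "\<forall>i<d. \<forall>m. \<exists>t. toeplitz (int (p i)) m (layer x i) t"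
  then obtain t where t: "toeplitz (int (p i)) m (layer x i) t" by blast
  have "toeplitz (int (p i)) m (\<lambda>n. layer x i (n + k i)) (t + k i)"
    using t by (simp add: toeplitz_translate)
  then show "\<exists>t. toeplitz (int (p i)) m (layer (translate k x) i) t"
    using i by (auto simp: translate_def layer_stack_fun)
qed

lemma translate_translate: "translate k (translate l x) = translate (\<lambda>i. k i + l i) x"
  by (auto simp: translate_def stack_def layer_stack layer_translate fun_eq_iff add.assoc
      intro!: arg_cong[of _ _ set_encode])

lemma translate_cong: "(\<And>i. i < d \<Longrightarrow> k i = l i) \<Longrightarrow> translate k x = translate l x"
  by (auto simp: translate_def stack_def fun_eq_iff intro!: arg_cong[of _ _ set_encode])

lemma translate_const: "x \<in> X \<Longrightarrow> translate (\<lambda>_. c) x = (\<lambda>n. x (n + c))"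
proof
  fix n assume x: "x \<in> X"
  show "translate (\<lambda>_. c) x n = x (n + c)"
    by (rule X_eqI) (use x in \<open>auto simp: translate_in_X layer_translate\<close>)
qed

lemma translate_0: "x \<in> X \<Longrightarrow> translate (\<lambda>_. 0) x = x"
  by (simp add: translate_const)

lemma shift_eq_translate: "x \<in> X \<Longrightarrow> shift x = translate (\<lambda>_. 1) x"
  by (simp add: translate_const shift_def)

lemma point_residue: "i < d \<Longrightarrow> toeplitz (int (p i)) m (layer (point t) i) (t i)"
  by (simp add: point_def layer_stack_fun toeplitz_def)

lemma point_in_X: "point t \<in> X"
  using point_residue by (auto simp: X_def point_def stack_in_symbols)

text \<open>For fixed \<open>t\<close> the condition restricts single coordinates and is closed. As
  \<open>t\<close> may be reduced modulo \<open>p i ^ m\<close>, the existential quantifier is a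
  finite union of such sets.\<close>

lemma closed_X: "closed X"
proof -
  let ?C = "\<lambda>i m t. {x. toeplitz (int (p i)) m (layer x i) t}"
  have cl: "closed ((\<lambda>x. x n) -` S)" for n and S :: "nat set"
    by (intro closed_vimage) (auto simp: closed_def open_discrete)
  have C: "closed (?C i m t)" for i m t
  proof -
    have eq: "?C i m t = (\<Inter>n\<in>{n. \<not> int (p i) ^ m dvd n + t}.
        (\<lambda>x. x n) -` {a. (i \<in> set_decode a) = odd (multiplicity (int (p i)) (n + t))})"
      by (auto simp: toeplitz_def layer_def)
    show ?thesis unfolding eq by (intro closed_INT ballI cl)
  qed
  have "(\<exists>t. toeplitz (int (p i)) m b t) \<longleftrightarrow> (\<exists>t\<in>{0..<int (p i) ^ m}. toeplitz (int (p i)) m b t)"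
    (is "?l \<longleftrightarrow> ?r") if i: "i < d" for i m b
  proof
    assume ?l
    then obtain t where "toeplitz (int (p i)) m b t" by blast
    moreover have "int (p i) ^ m dvd t - t mod int (p i) ^ m" by (simp add: dvd_minus_mod)
    ultimately have "toeplitz (int (p i)) m b (t mod int (p i) ^ m)"
      using toeplitz_cong int_p_ge[OF i] by blast
    moreover have "0 < int (p i) ^ m" using p_ge[OF i] by simp
    ultimately show ?r by (intro bexI[of _ "t mod int (p i) ^ m"]) auto
  qed blast
  then have "X = (\<Inter>n. (\<lambda>x. x n) -` symbols d) \<inter>
      (\<Inter>i\<in>{..<d}. \<Inter>m. \<Union>t\<in>{0..<int (p i) ^ m}. ?C i m t)"
    by (auto simp: X_def)
  moreover have "closed \<dots>"
    by (intro closed_Int closed_INT ballI closed_UN cl C) auto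
  ultimately show ?thesis by simp
qed

lemma subshift_X: "subshift (symbols d) X"
  unfolding subshift_def
proof (intro conjI)
  show "shift ` X = X"
  proof
    show "shift ` X \<subseteq> X" by (auto simp: shift_eq_translate translate_in_X)
    show "X \<subseteq> shift ` X"
    proof
      fix x assume x: "x \<in> X"
      then have "x = shift (translate (\<lambda>_. -1) x)"
        by (simp add: shift_eq_translate translate_in_X translate_translate translate_0)
      then show "x \<in> shift ` X" using x translate_in_X by blast
    qed
  qed
qed (auto simp: finite_symbols X_symbol closed_X)

lemma continuous_on_translate: "continuous_on S (translate k)"
proof (rule continuous_on_sliding)
  fix n
  define N where "N = \<bar>n\<bar> + (\<Sum>i<d. \<bar>k i\<bar>)"
  have N: "n + k i \<in> {-N..N}" if "i < d" for i
  proof -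
    have "\<bar>k i\<bar> \<le> (\<Sum>i<d. \<bar>k i\<bar>)" using that by (intro member_le_sum) auto
    then show ?thesis by (auto simp: N_def)
  qed
  have "translate k y n = translate k x n" if "\<forall>i\<in>{-N..N}. y i = x i" for x y
    using that N unfolding translate_def stack_def layer_def
    by (intro arg_cong[of _ _ set_encode] Collect_cong conj_cong) auto
  then show "\<exists>N. \<forall>x y. (\<forall>i\<in>{-N..N}. y i = x i) \<longrightarrow> translate k y n = translate k x n"
    by blast
qed

section \<open>Minimality\<close>

text \<open>A window of length less than \<open>p ^ m\<close> contains at most one position \<open>l\<close> where \<open>y\<close> is not
  determined by its residue modulo \<open>p ^ m\<close>. There the value of \<open>y\<close> is realised by \<open>x\<close> at a
  position of valuation \<open>m\<close> or \<open>m + 1\<close>, according to the parity needed.\<close>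

lemma layer_recurrence:
  assumes x: "x \<in> X" and y: "y \<in> X" and i: "i < d" and m: "2 * N < int (p i) ^ m"
  shows "\<exists>w. \<forall>k. int (p i) ^ (m + 2) dvd k - w \<longrightarrow>
    (\<forall>n\<in>{-N..N}. layer y i n = layer x i (n + k))"
proof -
  define P where "P = int (p i)"
  have P: "P \<ge> 2" using int_p_ge[OF i] by (simp add: P_def)
  obtain t where t: "toeplitz P (m + 2) (layer x i) t" using X_residue[OF x i] P_def by blast
  obtain s where s: "toeplitz P m (layer y i) s" using X_residue[OF y i] P_def by blast
  have t': "toeplitz P m (layer x i) t" using toeplitz_mono[OF _ t] by simp
  define H where "H = (\<lambda>n. n \<in> {-N..N} \<and> P ^ m dvd n + s)"
  have H_unique: "n = l" if "H n" "H l" for n l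
  proof (rule ccontr)
    assume "n \<noteq> l"
    have "P ^ m dvd (n + s) - (l + s)" using that by (intro dvd_diff) (auto simp: H_def)
    then have "P ^ m dvd n - l" by simp
    then have "P ^ m \<le> \<bar>n - l\<bar>" using \<open>n \<noteq> l\<close> dvd_imp_le_int[of "n - l" "P ^ m"] P by simp
    then show False using that m by (auto simp: H_def P_def)
  qed
  \<comment> \<open>\<open>u\<close> is the value that \<open>k + t\<close> should have modulo
    \<open>P ^ (m + 2)\<close>. It agrees with \<open>s\<close> modulo \<open>P ^ m\<close>, and at
    an undetermined position \<open>l\<close> it makes \<open>l + u\<close> a power
    \<open>P ^ c\<close> whose exponent has the parity of the bit. Since \<open>c < m + 2\<close>,
    level \<open>m + 2\<close> of \<open>x\<close> sees this exponent.\<close>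
  obtain u where u: "P ^ m dvd u - s"
    "\<And>l. H l \<Longrightarrow> \<exists>c. u = P ^ c - l \<and> c < m + 2 \<and> (layer y i l \<longleftrightarrow> odd c)"
  proof (cases "\<exists>l. H l")
    case True
    then obtain l where l: "H l" by blast
    define c where "c = (if layer y i l \<longleftrightarrow> odd m then m else m + 1)"
    have "P ^ m dvd P ^ c - (l + s)"
      using l by (intro dvd_diff le_imp_power_dvd) (auto simp: H_def c_def)
    then have 1: "P ^ m dvd P ^ c - l - s" by (simp add: algebra_simps)
    have 2: "c < m + 2" "layer y i l \<longleftrightarrow> odd c" by (auto simp: c_def)
    show ?thesis
      by (rule that[OF 1]) (use 2 H_unique[OF l] in blast)
  next
    case False
    then show ?thesis by (intro that[of s]) auto
  qed
  have "layer y i n = layer x i (n + k)"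
    if k: "P ^ (m + 2) dvd k - (u - t)" and n: "n \<in> {-N..N}" for k n
  proof (cases "H n")
    case True
    then obtain c where c: "u = P ^ c - n" "c < m + 2" "layer y i n \<longleftrightarrow> odd c" using u(2) by blast
    have "P ^ (m + 2) dvd P ^ c - (n + k + t)"
      using k dvd_minus_iff[of "P ^ (m + 2)" "k - (u - t)"] c(1) by (simp add: algebra_simps)
    moreover have ndvd: "\<not> P ^ (m + 2) dvd P ^ c"
      using c(2) P by (intro zdvd_not_zless power_strict_increasing) auto
    ultimately have "multiplicity P (P ^ c) = multiplicity P (n + k + t)"
      "\<not> P ^ (m + 2) dvd n + k + t"
      using multiplicity_cong_power[OF P ndvd] dvd_add[of "P ^ (m + 2)" "P ^ c - (n + k + t)" "n + k + t"]
      by auto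
    moreover have "multiplicity P (P ^ c) = c"
      using P by (intro multiplicity_same_power) (auto simp: zdvd_not_zless)
    ultimately show ?thesis using toeplitzD[OF t, of "n + k"] c(3) by simp
  next
    case False
    then have ns: "\<not> P ^ m dvd n + s" using n by (simp add: H_def)
    have "P ^ m dvd k - (u - t)" using dvd_trans[OF le_imp_power_dvd k, of m] by simp
    from dvd_add[OF this u(1)] have 1: "P ^ m dvd (n + k + t) - (n + s)"
      by (simp add: algebra_simps)
    then have 2: "\<not> P ^ m dvd n + k + t"
      using ns dvd_diff[of "P ^ m" "n + k + t" "(n + k + t) - (n + s)"] by auto
    show ?thesis
      using toeplitzD[OF s ns] toeplitzD[OF t' 2] multiplicity_cong_power[OF P 2 1] by simp
  qed
  then show ?thesis unfolding P_def by blast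
qed

text \<open>The Chinese remainder theorem meets the congruences of \<open>layer_recurrence\<close>
  for all layers with one \<open>k\<close>. Adding multiples of the product of the moduli pushes
  \<open>k\<close> beyond \<open>B\<close>, which later serves to avoid holes.\<close>

lemma recurrence:
  assumes x: "x \<in> X" and y: "y \<in> X"
  shows "\<exists>k>B. \<forall>n\<in>{-N..N}. y n = x (n + k)"
proof -
  \<comment> \<open>From \<open>2 * N < m < 2 ^ m\<close> this one exponent works for all
    layers.\<close>
  define m where "m = nat (2 * N + 2)"
  have "2 * N < int (p i) ^ m" if "i < d" for i
  proof -
    have "2 * N < int m" by (simp add: m_def)
    also have "int m < 2 ^ m" by (rule of_nat_less_two_power)
    also have "\<dots> \<le> int (p i) ^ m" using int_p_ge[OF that] by (intro power_mono) auto
    finally show ?thesis .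
  qed
  then have "\<forall>i\<in>{..<d}. \<exists>w. \<forall>k. int (p i) ^ (m + 2) dvd k - w \<longrightarrow>
      (\<forall>n\<in>{-N..N}. layer y i n = layer x i (n + k))"
    using layer_recurrence[OF x y] by auto
  from bchoice[OF this] obtain w where w: "\<And>i k n. i < d \<Longrightarrow> int (p i) ^ (m + 2) dvd k - w i \<Longrightarrow>
      n \<in> {-N..N} \<Longrightarrow> layer y i n = layer x i (n + k)" by blast
  define M where "M = (\<lambda>i. p i ^ (m + 2))"
  have "\<forall>i\<in>{..<d}. \<forall>j\<in>{..<d}. i \<noteq> j \<longrightarrow> coprime (M i) (M j)"
    using p_coprime by (simp add: M_def)
  from chinese_remainder_nat[OF _ this, of "\<lambda>i. nat (w i mod int (M i))"]
  obtain z where z: "\<And>i. i < d \<Longrightarrow> [z = nat (w i mod int (M i))] (mod M i)" by auto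
  have M_pos: "0 < M i" if "i < d" for i using p_ge[OF that] by (simp add: M_def)
  define k where "k = int z + int (\<Prod>i<d. M i) * (\<bar>B\<bar> + 1)"
  have "0 < (\<Prod>i<d. M i)" using M_pos by (intro prod_pos) auto
  then have "1 \<le> int (\<Prod>i<d. M i)" by linarith
  from mult_right_mono[OF this, of "\<bar>B\<bar> + 1"]
  have "\<bar>B\<bar> + 1 \<le> int (\<Prod>i<d. M i) * (\<bar>B\<bar> + 1)" by simp
  then have "k > B" unfolding k_def using abs_ge_self[of B] of_nat_0_le_iff[of z] by linarith
  moreover have "y n = x (n + k)" if n: "n \<in> {-N..N}" for n
  proof (rule X_eqI[OF y x])
    fix i assume i: "i < d"
    have "[int z = int (nat (w i mod int (M i)))] (mod int (M i))"
      using z[OF i] by (simp only: cong_int_iff)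
    then have "[int z = w i] (mod int (M i))" using M_pos[OF i] by (simp add: cong_def)
    then have "int (M i) dvd int z - w i" by (simp add: cong_iff_dvd_diff)
    moreover have "int (M i) dvd int (\<Prod>i<d. M i) * (\<bar>B\<bar> + 1)"
      using i by (intro dvd_mult2) (simp only: int_dvd_int_iff, intro dvd_prodI, auto)
    ultimately have "int (M i) dvd (int z - w i) + int (\<Prod>i<d. M i) * (\<bar>B\<bar> + 1)" by (rule dvd_add)
    then have "int (p i) ^ (m + 2) dvd k - w i" by (simp add: k_def M_def algebra_simps)
    from w[OF i this n] show "layer y i n = layer x i (n + k)" .
  qed
  ultimately show ?thesis by blast
qed

lemma minimal_shift_X: "minimal_shift X"
  unfolding minimal_shift_def
proof (intro ballI subsetI)
  fix x y assume x: "x \<in> X" and y: "y \<in> X"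
  show "y \<in> closure (orbit x)"
    unfolding closure_iff_nhds_not_empty
  proof (intro allI impI)
    fix A S assume S: "S \<subseteq> A" "open S" "y \<in> S"
    obtain N where N: "\<And>z. (\<And>n. n \<in> {-N..N} \<Longrightarrow> z n = y n) \<Longrightarrow> z \<in> S"
      using open_contains_cylinder[OF S(2,3)] by blast
    obtain k where k: "\<forall>n\<in>{-N..N}. y n = x (n + k)" using recurrence[OF x y] by blast
    have "(\<lambda>n. x (n + k)) \<in> S" by (rule N) (simp add: k)
    moreover have "(\<lambda>n. x (n + k)) \<in> orbit x" by (auto simp: orbit_def)
    ultimately show "orbit x \<inter> A \<noteq> {}" using S(1) by blast
  qed
qed

section \<open>Complexity\<close>

text \<open>In layer \<open>i\<close> a window of length at most \<open>p i ^ e i\<close> is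
  described by a residue modulo \<open>p i ^ e i\<close> and one bit for the at most one position
  that the residue leaves open.\<close>

lemma card_words_le:
  assumes n: "\<And>i. i < d \<Longrightarrow> n \<le> p i ^ e i"
  shows "finite (words X n)" "card (words X n) \<le> (\<Prod>i<d. 2 * p i ^ e i)"
proof -
  define word :: "(nat \<Rightarrow> int \<times> bool) \<Rightarrow> nat list" where "word = (\<lambda>f. map (\<lambda>j. stack d (\<lambda>i l.
    if int (p i) ^ e i dvd l + fst (f i) then snd (f i)
    else odd (multiplicity (int (p i)) (l + fst (f i)))) (int j)) [0..<n])"
  define D where "D = (\<Pi>\<^sub>E i\<in>{..<d}. {0..<int (p i ^ e i)} \<times> (UNIV :: bool set))"
  have D: "finite D" by (auto simp: D_def intro!: finite_PiE)
  have cD: "card D = (\<Prod>i<d. 2 * p i ^ e i)"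
    by (simp add: D_def card_PiE card_cartesian_product mult.commute nat_power_eq)
  have sub: "words X n \<subseteq> word ` D"
  proof
    fix w assume "w \<in> words X n"
    then obtain x k where x: "x \<in> X" and w: "w = map (\<lambda>j. x (k + int j)) [0..<n]"
      by (auto simp: words_def)
    have "\<forall>i\<in>{..<d}. \<exists>t. toeplitz (int (p i)) (e i) (layer x i) t" using X_residue[OF x] by auto
    from bchoice[OF this] obtain t
      where t: "\<And>i. i < d \<Longrightarrow> toeplitz (int (p i)) (e i) (layer x i) (t i)" by blast
    \<comment> \<open>The residue is taken relative to the start \<open>k\<close> of the window. The
      bit is \<open>False\<close> by default when the window has no open position.\<close>
    define f where "f = (\<lambda>i\<in>{..<d}. ((k + t i) mod int (p i ^ e i),
      \<exists>j<n. int (p i) ^ e i dvd k + int j + t i \<and> layer x i (k + int j)))"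
    have "f \<in> D" using p_ge by (force simp: D_def f_def)
    moreover have "word f = w"
      unfolding word_def w
    proof (intro map_cong refl symbol_eqI[where d = d])
      fix j i assume "j \<in> set [0..<n]" and i: "i < d"
      then have j: "j < n" by simp
      define P where "P = int (p i)"
      define r where "r = (k + t i) mod P ^ e i"
      have P: "P \<ge> 2" using int_p_ge[OF i] by (simp add: P_def)
      have f: "fst (f i) = r" "snd (f i) = (\<exists>j<n. P ^ e i dvd k + int j + t i \<and> layer x i (k + int j))"
        using i by (simp_all add: f_def r_def P_def)
      have "P ^ e i dvd (k + t i) - r" by (simp add: r_def dvd_minus_mod)
      then have r: "P ^ e i dvd (k + int j + t i) - (int j + r)" by (simp add: algebra_simps)
      have "(if P ^ e i dvd int j + r then snd (f i) else odd (multiplicity P (int j + r)))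
        = layer x i (k + int j)"
      proof (cases "P ^ e i dvd int j + r")
        case True
        have jd: "P ^ e i dvd k + int j + t i" using dvd_add[OF r True] by (simp add: algebra_simps)
        have "l = j" if l: "l < n" "P ^ e i dvd k + int l + t i" for l
        proof (rule ccontr)
          assume "l \<noteq> j"
          have "P ^ e i dvd int l - int j" using dvd_diff[OF l(2) jd] by simp
          then have "P ^ e i \<le> \<bar>int l - int j\<bar>"
            using \<open>l \<noteq> j\<close> P dvd_imp_le_int[of "int l - int j" "P ^ e i"] by simp
          moreover have "int n \<le> P ^ e i"
            using n[OF i] unfolding P_def by (simp only: of_nat_power[symmetric] of_nat_le_iff)
          ultimately show False using l(1) j by linarith
        qed
        then have "snd (f i) = layer x i (k + int j)" using jd j unfolding f(2) by metis
        then show ?thesis using True by simp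
      next
        case False
        then have nd: "\<not> P ^ e i dvd k + int j + t i"
          using dvd_diff[OF _ r, of "k + int j + t i"] by auto
        show ?thesis
          using toeplitzD[OF t[OF i], of "k + int j"] nd False multiplicity_cong_power[OF P nd r]
          by (simp add: P_def)
      qed
      then show "layer (stack d (\<lambda>i l. if int (p i) ^ e i dvd l + fst (f i) then snd (f i)
          else odd (multiplicity (int (p i)) (l + fst (f i))))) i (int j) = layer x i (k + int j)"
        using i f(1) unfolding P_def by (auto simp: layer_stack split: if_splits)
    qed (auto simp: stack_in_symbols X_symbol[OF x])
    ultimately show "w \<in> word ` D" by blast
  qed
  show "finite (words X n)" using sub D finite_surj by blast
  show "card (words X n) \<le> (\<Prod>i<d. 2 * p i ^ e i)"
    using surj_card_le[OF D sub] cD by simp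
qed

text \<open>Residues in different layers can be chosen independently, and a window of length
  \<open>p i ^ Suc (e i)\<close> recovers the residue modulo \<open>p i ^ e i\<close> by
  \<open>toeplitz_residue_unique\<close>.\<close>

lemma card_words_ge:
  assumes n: "\<And>i. i < d \<Longrightarrow> p i ^ Suc (e i) \<le> n" and fin: "finite (words X n)"
  shows "(\<Prod>i<d. p i ^ e i) \<le> card (words X n)"
proof -
  define D where "D = (\<Pi>\<^sub>E i\<in>{..<d}. {0..<int (p i ^ e i)})"
  let ?w = "\<lambda>f. map (\<lambda>j. point f (0 + int j)) [0..<n]"
  have "inj_on ?w D"
  proof (rule inj_onI)
    fix f g assume fg: "f \<in> D" "g \<in> D" and eq: "?w f = ?w g"
    have "f i = g i" if i: "i < d" for i
    proof -
      have eq': "point f l = point g l" if "0 \<le> l" "l < 0 + int (p i) ^ Suc (e i)" for l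
      proof -
        have "int (p i ^ Suc (e i)) \<le> int n" using n[OF i] by (simp only: of_nat_le_iff)
        then have "nat l < n" using that by auto
        then show ?thesis using eq that(1) by (auto dest!: bspec[of _ _ "nat l"])
      qed
      have "int (p i) ^ e i dvd f i - g i"
        by (rule toeplitz_residue_unique[where a = 0, OF int_p_ge[OF i] point_residue[OF i] point_residue[OF i]])
          (use eq' in \<open>simp add: layer_def\<close>)
      moreover have "f i \<in> {0..<int (p i) ^ e i}" "g i \<in> {0..<int (p i) ^ e i}"
        using fg i by (auto simp: D_def dest!: PiE_mem[where x = i])
      ultimately show ?thesis
        by (metis mod_eq_dvd_iff atLeastLessThan_iff mod_pos_pos_trivial)
    qed
    then show "f = g" using fg unfolding D_def by (intro PiE_ext[of f "{..<d}" _ g]) auto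
  qed
  moreover have "?w ` D \<subseteq> words X n" unfolding words_def using point_in_X by blast
  ultimately have "card D \<le> card (words X n)" using fin by (metis card_image card_mono)
  then show ?thesis by (simp add: D_def card_PiE nat_power_eq)
qed

text \<open>Rounding \<open>n\<close> up to a power of \<open>p i\<close> costs at most a factor
  \<open>p i\<close>. For the lower bound it is rounded down and one more factor is lost to the
  window length, hence \<open>p i * p i\<close>.\<close>

lemma complexity_X: "(\<lambda>n. real (complexity X n)) \<in> \<Theta>(\<lambda>n. real n ^ d)"
proof (rule bigthetaI)
  have up: "complexity X n \<le> (\<Prod>i<d. 2 * p i) * n ^ d" "finite (words X n)" if n: "n \<ge> 1" for n
  proof -
    have "\<exists>e. n \<le> p i ^ e \<and> p i ^ e \<le> p i * n" if i: "i < d" for i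
    proof -
      obtain e where "p i ^ e \<le> n" "n < p i ^ (e + 1)" using ex_power_ivl1[OF p_ge[OF i] n] by blast
      then show ?thesis by (intro exI[of _ "e + 1"]) auto
    qed
    then obtain e where e: "\<And>i. i < d \<Longrightarrow> n \<le> p i ^ e i \<and> p i ^ e i \<le> p i * n" by metis
    show "finite (words X n)" by (rule card_words_le) (use e in auto)
    have "complexity X n \<le> (\<Prod>i<d. 2 * p i ^ e i)"
      unfolding complexity_def by (rule card_words_le) (use e in auto)
    also have "\<dots> \<le> (\<Prod>i<d. 2 * p i * n)" using e by (intro prod_mono) auto
    also have "\<dots> = (\<Prod>i<d. 2 * p i) * n ^ d" by (simp add: prod.distrib mult_ac)
    finally show "complexity X n \<le> (\<Prod>i<d. 2 * p i) * n ^ d" .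
  qed
  have low: "n ^ d \<le> (\<Prod>i<d. p i * p i) * complexity X n"
    if n: "n \<ge> 1" "\<And>i. i < d \<Longrightarrow> n \<ge> p i" for n
  proof -
    have "\<exists>e. p i ^ Suc e \<le> n \<and> n \<le> p i * p i * p i ^ e" if i: "i < d" for i
    proof -
      obtain e where e: "p i ^ e \<le> n" "n < p i ^ (e + 1)" using ex_power_ivl1[OF p_ge[OF i] n(1)] by blast
      \<comment> \<open>The assumption \<open>n \<ge> p i\<close> leaves room to lower the exponent
        by one.\<close>
      have "e \<noteq> 0" using e(2) n(2)[OF i] by (cases e) auto
      then obtain e' where "e = Suc e'" using not0_implies_Suc by blast
      then show ?thesis using e by (intro exI[of _ e']) (auto simp: mult_ac)
    qed
    then obtain e where e: "\<And>i. i < d \<Longrightarrow> p i ^ Suc (e i) \<le> n \<and> n \<le> p i * p i * p i ^ e i" by metis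
    have "n ^ d = (\<Prod>i<d. n)" by simp
    also have "\<dots> \<le> (\<Prod>i<d. p i * p i * p i ^ e i)" using e by (intro prod_mono) auto
    also have "\<dots> = (\<Prod>i<d. p i * p i) * (\<Prod>i<d. p i ^ e i)" by (simp add: prod.distrib)
    also have "\<dots> \<le> (\<Prod>i<d. p i * p i) * complexity X n"
      unfolding complexity_def using e up(2)[OF n(1)] by (intro mult_left_mono card_words_ge) auto
    finally show ?thesis .
  qed
  show "(\<lambda>n. real (complexity X n)) \<in> O(\<lambda>n. real n ^ d)"
  \<comment> \<open>The rule asks for a positive constant; the added 1 makes positivity
    immediate.\<close>
  proof (rule landau_o.bigI)
    show "\<forall>\<^sub>F n in sequentially. norm (real (complexity X n)) \<le>
        (real (\<Prod>i<d. 2 * p i) + 1) * norm (real n ^ d)"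
      using eventually_ge_at_top[of 1]
    proof eventually_elim
      case (elim n)
      have "real (complexity X n) \<le> real ((\<Prod>i<d. 2 * p i) * n ^ d)" using up(1)[OF elim] of_nat_mono by blast
      also have "\<dots> \<le> (real (\<Prod>i<d. 2 * p i) + 1) * real n ^ d"
        unfolding of_nat_mult of_nat_power by (intro mult_right_mono) auto
      finally show ?case by simp
    qed
  qed (simp add: add_nonneg_pos prod_nonneg)
  show "(\<lambda>n. real (complexity X n)) \<in> \<Omega>(\<lambda>n. real n ^ d)"
    unfolding bigomega_iff_bigo
  proof (rule landau_o.bigI)
    show "\<forall>\<^sub>F n in sequentially. norm (real n ^ d) \<le>
        (real (\<Prod>i<d. p i * p i) + 1) * norm (real (complexity X n))"
      using eventually_ge_at_top[of "Max (insert 1 (p ` {..<d}))"]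
    proof eventually_elim
      case (elim n)
      then have n: "n \<ge> 1" "\<And>i. i < d \<Longrightarrow> n \<ge> p i" by auto
      have "real n ^ d \<le> real ((\<Prod>i<d. p i * p i) * complexity X n)"
        using of_nat_mono[OF low[OF n], where 'a = real] by simp
      also have "\<dots> \<le> (real (\<Prod>i<d. p i * p i) + 1) * real (complexity X n)"
        unfolding of_nat_mult by (intro mult_right_mono) auto
      finally show ?case by simp
    qed
  qed (simp add: add_nonneg_pos prod_nonneg)
qed

section \<open>Automorphisms\<close>

text \<open>A window to the right of \<open>R\<close> forces the residues of \<open>x\<close> and
  \<open>y\<close> to agree modulo every power of \<open>p i\<close>. Off the class of minus that
  residue both layers are then equal, so a discrepancy at \<open>n\<close> reveals the residue
  \<open>- n\<close>.\<close>

lemma discrepancy_residue: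
  assumes x: "x \<in> X" and y: "y \<in> X" and eq: "\<And>n. n > R \<Longrightarrow> x n = y n"
    and i: "i < d" and ne: "layer x i n \<noteq> layer y i n"
  shows "toeplitz (int (p i)) m (layer x i) (- n)"
proof -
  define P where "P = int (p i)"
  have P: "P \<ge> 2" using int_p_ge[OF i] by (simp add: P_def)
  obtain t where t: "toeplitz P (Suc m) (layer x i) t" using X_residue[OF x i] P_def by blast
  obtain s where s: "toeplitz P (Suc m) (layer y i) s" using X_residue[OF y i] P_def by blast
  have "P ^ m dvd t - s"
    by (rule toeplitz_residue_unique[where a = "R + 1", OF P t s]) (simp add: layer_def eq)
  then have s': "P ^ m dvd s - t" by (simp add: dvd_diff_commute)
  have tx: "toeplitz P m (layer x i) t" using toeplitz_mono[OF _ t] by simp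
  have ty: "toeplitz P m (layer y i) t"
    using toeplitz_cong[OF P s'] toeplitz_mono[OF _ s] by simp
  have "P ^ m dvd n + t" using toeplitzD[OF tx] toeplitzD[OF ty] ne by blast
  then have "P ^ m dvd t - (- n)" by (simp add: add.commute)
  from toeplitz_cong[OF P this tx] show ?thesis by (simp add: P_def)
qed

text \<open>A nonzero \<open>n + k\<close> has finite valuation, so a high enough level determines
  the bit at \<open>n\<close>.\<close>

lemma layer_integer_residue:
  assumes i: "i < d" and "\<And>m. toeplitz (int (p i)) m (layer u i) k" and "n + k \<noteq> 0"
  shows "layer u i n = odd (multiplicity (int (p i)) (n + k))"
proof -
  define P where "P = int (p i)"
  have "P \<ge> 2" using int_p_ge[OF i] by (simp add: P_def)
  then have "\<not> is_unit P" by (auto simp: zdvd_not_zless)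
  with assms(3) have "\<not> P ^ Suc (multiplicity P (n + k)) dvd n + k"
    by (subst power_dvd_iff_le_multiplicity) auto
  with assms(2) show ?thesis unfolding P_def by (blast dest: toeplitzD)
qed

text \<open>These are the points with all residues 0; \<open>S\<close> is the set of layers whose
  hole at 0 is filled with \<open>True\<close>.\<close>

definition hole_point :: "nat set \<Rightarrow> int \<Rightarrow> nat"
  where "hole_point S = stack d (\<lambda>i n. if n = 0 then i \<in> S else odd (multiplicity (int (p i)) n))"

lemma layer_hole_point:
  "i < d \<Longrightarrow> layer (hole_point S) i n = (if n = 0 then i \<in> S else odd (multiplicity (int (p i)) n))"
  by (simp add: hole_point_def layer_stack)

lemma hole_point_in_X: "hole_point S \<in> X"
proof -
  have "toeplitz (int (p i)) m (layer (hole_point S) i) 0" if "i < d" for i m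
    using that by (auto simp: toeplitz_def layer_hole_point)
  then have "\<forall>i<d. \<forall>m. \<exists>t. toeplitz (int (p i)) m (layer (hole_point S) i) t" by blast
  moreover have "hole_point S \<in> UNIV \<rightarrow> symbols d" by (auto simp: hole_point_def stack_in_symbols)
  ultimately show ?thesis by (simp add: X_def)
qed

lemma hole_point_eq: "n \<noteq> 0 \<Longrightarrow> hole_point S n = hole_point T n"
  by (rule X_eqI) (auto simp: hole_point_in_X layer_hole_point)

lemma hole_point_inj:
  assumes "S \<subseteq> {..<d}" "T \<subseteq> {..<d}" "hole_point S = hole_point T"
  shows "S = T"
proof -
  have "i \<in> S \<longleftrightarrow> i \<in> T" if "i < d" for i
    using layer_hole_point[OF that, of S 0] layer_hole_point[OF that, of T 0] assms(3) by simp
  then show ?thesis using assms(1,2) by blast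
qed

text \<open>The \<open>2 ^ d\<close> points \<open>hole_point S\<close> are pairwise asymptotic, so their images under an
  automorphism differ from each other only at holes, at most one in each layer. For \<open>2 ^ d\<close>
  distinct images every layer needs a hole.\<close>

lemma image_integer_residues:
  assumes f: "\<And>x. x \<in> X \<Longrightarrow> f x \<in> X" "inj_on f X"
    and R: "\<And>x y k. x \<in> X \<Longrightarrow> y \<in> X \<Longrightarrow> (\<And>n. n \<in> {k - R..k + R} \<Longrightarrow> x n = y n) \<Longrightarrow> f x k = f y k"
  shows "\<exists>k. \<forall>i<d. \<forall>m. toeplitz (int (p i)) m (layer (f (hole_point {})) i) (k i)"
proof -
  define u where "u = f (hole_point {})"
  have uX: "u \<in> X" by (simp add: u_def f(1) hole_point_in_X)
  have fX: "f (hole_point S) \<in> X" for S by (simp add: f(1) hole_point_in_X)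
  have far: "u n = f (hole_point S) n" if "n > R" for S n
    unfolding u_def by (rule R) (use that in \<open>auto simp: hole_point_in_X intro!: hole_point_eq\<close>)
  \<comment> \<open>\<open>J\<close> collects the layers in which some image differs from
    \<open>u\<close>; the aim is to show that these are all layers.\<close>
  define J where "J = {i \<in> {..<d}. \<exists>S n. layer u i n \<noteq> layer (f (hole_point S)) i n}"
  have "\<forall>i\<in>J. \<exists>k. \<exists>S. layer u i (- k) \<noteq> layer (f (hole_point S)) i (- k)"
  proof
    fix i assume "i \<in> J"
    then obtain S n where "layer u i n \<noteq> layer (f (hole_point S)) i n" by (auto simp: J_def)
    then have "layer u i (- (- n)) \<noteq> layer (f (hole_point S)) i (- (- n))" by simp
    then show "\<exists>k. \<exists>S. layer u i (- k) \<noteq> layer (f (hole_point S)) i (- k)" by blast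
  qed
  from bchoice[OF this] obtain k where k:
    "\<And>i. i \<in> J \<Longrightarrow> \<exists>S. layer u i (- k i) \<noteq> layer (f (hole_point S)) i (- k i)" by blast
  have res: "toeplitz (int (p i)) m (layer u i) (- n)"
    if "i < d" "layer u i n \<noteq> layer (f (hole_point S)) i n" for i n S m
    using discrepancy_residue[OF uX fX far] that by blast
  have kres: "toeplitz (int (p i)) m (layer u i) (k i)" if i: "i \<in> J" for i m
  proof -
    obtain S where "layer u i (- k i) \<noteq> layer (f (hole_point S)) i (- k i)" using k[OF i] by blast
    then show ?thesis using res[of i "- k i" S m] i by (simp add: J_def)
  qed
  \<comment> \<open>A discrepancy at \<open>n\<close> gives \<open>u\<close> the integer residue
    \<open>- n\<close> in that layer, and integer residues are unique.\<close>
  have at: "n = - k i" if i: "i < d" and ne: "layer u i n \<noteq> layer (f (hole_point S)) i n" for i n S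
  proof -
    have "i \<in> J" using that by (auto simp: J_def)
    from toeplitz_integer_residue_unique[OF int_p_ge[OF i] res[OF i ne] kres[OF this]]
    show ?thesis by simp
  qed
  \<comment> \<open>Images agree with \<open>u\<close> except possibly at the positions
    \<open>- k i\<close> for \<open>i\<close> in \<open>J\<close>, so these bits determine the image
    of \<open>hole_point S\<close>.\<close>
  define F where "F = (\<lambda>S. {i \<in> J. layer (f (hole_point S)) i (- k i)})"
  have "inj_on F (Pow {..<d})"
  proof (rule inj_onI)
    fix S T assume S: "S \<in> Pow {..<d}" and T: "T \<in> Pow {..<d}" and eq: "F S = F T"
    have "f (hole_point S) n = f (hole_point T) n" for n
    proof (rule X_eqI[OF fX fX])
      fix i assume i: "i < d"
      show "layer (f (hole_point S)) i n = layer (f (hole_point T)) i n"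
      proof (cases "i \<in> J \<and> n = - k i")
        case True
        then show ?thesis using eq by (auto simp: F_def)
      next
        case False
        have "layer u i n = layer (f (hole_point V)) i n" for V
          using at[OF i, of n V] False i by (auto simp: J_def)
        then show ?thesis by metis
      qed
    qed
    then have "f (hole_point S) = f (hole_point T)" by blast
    then have "hole_point S = hole_point T" using f(2) hole_point_in_X by (auto dest: inj_onD)
    then show "S = T" using S T hole_point_inj by blast
  qed
  moreover have J: "finite J" "J \<subseteq> {..<d}" by (auto simp: J_def)
  moreover have "F ` Pow {..<d} \<subseteq> Pow J" by (auto simp: F_def)
  ultimately have "card (Pow {..<d}) \<le> card (Pow J)" by (intro card_inj_on_le) auto
  then have "d \<le> card J" by (simp add: card_Pow J(1))
  then have "J = {..<d}" using J(2) by (intro card_seteq) auto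
  then show ?thesis using kres unfolding u_def by blast
qed

text \<open>Away from the holes the integer residues of \<open>f z\<close> make it the translate of
  \<open>z\<close> by \<open>k\<close>. Any window of \<open>x\<close> recurs in \<open>z\<close>
  far to the right, and the block code transfers the identity to \<open>x\<close>.\<close>

lemma automorphism_is_translate:
  assumes f: "f \<in> shift_auts X"
  shows "\<exists>k. \<forall>x\<in>X. f x = translate k x"
proof -
  obtain g where g: "homeomorphism X X f g" using f by (auto simp: shift_auts_def)
  have fX: "f x \<in> X" if "x \<in> X" for x using g that by (auto simp: homeomorphism_def)
  have inj: "inj_on f X" using f shift_auts_Bij by (auto simp: Bij_def bij_betw_def)
  have com: "f (shift x) = shift (f x)" if "x \<in> X" for x using f that by (auto simp: shift_auts_def)
  have cont: "continuous_on X f" using g by (simp add: homeomorphism_def)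
  obtain R where R: "R \<ge> 0" "\<And>x y k. x \<in> X \<Longrightarrow> y \<in> X \<Longrightarrow>
      (\<And>n. n \<in> {k - R..k + R} \<Longrightarrow> x n = y n) \<Longrightarrow> f x k = f y k"
    using sliding_block_code[where f = f and X = X, OF subshift_X cont com] by blast
  define z where "z = hole_point {}"
  have z: "z \<in> X" by (simp add: z_def hole_point_in_X)
  obtain k where k: "\<And>i m. i < d \<Longrightarrow> toeplitz (int (p i)) m (layer (f z) i) (k i)"
    using image_integer_residues[OF fX inj R(2)] unfolding z_def by blast
  have "f x n = translate k x n" if x: "x \<in> X" for x n
  proof -
    define K where "K = (\<Sum>i<d. \<bar>k i\<bar>)"
    have K: "\<bar>k i\<bar> \<le> K" if "i < d" for i
      unfolding K_def using that by (intro member_le_sum) auto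
    \<comment> \<open>The window contains both the block of radius \<open>R\<close> around
      \<open>n\<close> and all positions \<open>n + k i\<close>.\<close>
    define N where "N = \<bar>n\<bar> + R + K"
    have K0: "0 \<le> K" by (simp add: K_def sum_nonneg)
    \<comment> \<open>The bound on \<open>l\<close> makes \<open>n + l + k i\<close> positive, which
      avoids the holes of \<open>f z\<close> and of \<open>z\<close>.\<close>
    obtain l where l: "l > \<bar>n\<bar> + K" "\<forall>j\<in>{-N..N}. x j = z (j + l)"
      using recurrence[OF z x] by blast
    have tr: "(\<lambda>j. z (j + l)) \<in> X" "f (\<lambda>j. z (j + l)) = (\<lambda>j. f z (j + l))"
      using translate_commute[of X f z l] subshift_X com z by (auto simp: subshift_def)
    have "j \<in> {-N..N}" if "j \<in> {n - R..n + R}" for j using that K0 by (auto simp: N_def)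
    then have "f x n = f (\<lambda>j. z (j + l)) n" using R(2)[OF x tr(1)] l(2) by blast
    then have 1: "f x n = f z (n + l)" by (simp add: tr(2))
    have "f z (n + l) = translate k x n"
    proof (rule X_eqI[OF fX[OF z] translate_in_X[OF x]])
      fix i assume i: "i < d"
      have nk: "n + k i \<in> {-N..N}" using K[OF i] R(1) by (auto simp: N_def)
      have ne: "n + l + k i \<noteq> 0" using l(1) K[OF i] by linarith
      have "layer (f z) i (n + l) = odd (multiplicity (int (p i)) (n + l + k i))"
        by (rule layer_integer_residue[OF i k[OF i] ne])
      also have "\<dots> = layer z i (n + k i + l)"
        using ne i by (simp add: z_def layer_hole_point algebra_simps)
      also have "\<dots> = layer x i (n + k i)" using l(2) nk by (simp add: layer_def)
      finally show "layer (f z) i (n + l) = layer (translate k x) i n"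
        by (simp add: layer_translate[OF i])
    qed
    with 1 show ?thesis by simp
  qed
  then show ?thesis by blast
qed

lemma translate_automorphism: "restrict (translate k) X \<in> shift_auts X"
proof -
  have inv: "translate (\<lambda>i. - l i) (translate l x) = x" "translate l (translate (\<lambda>i. - l i) x) = x"
    if "x \<in> X" for x l
    using that by (simp_all add: translate_translate translate_0)
  have "homeomorphism X X (translate k) (translate (\<lambda>i. - k i))"
    by (rule homeomorphismI) (auto simp: continuous_on_translate translate_in_X inv)
  then have "homeomorphism X X (restrict (translate k) X) (translate (\<lambda>i. - k i))"
    by (rule homeomorphism_cong) auto
  moreover have "translate k (shift x) = shift (translate k x)" if "x \<in> X" for x
    using that by (simp add: shift_eq_translate translate_in_X translate_translate add.commute)
  moreover have "shift x \<in> X" if "x \<in> X" for x using that by (simp add: shift_eq_translate translate_in_X)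
  ultimately show ?thesis by (auto simp: shift_auts_def)
qed

text \<open>Translating the point with residues 0 by a vector \<open>j\<close> turns its residue in
  layer \<open>i\<close> into \<open>j i\<close>, which is unique.\<close>

lemma translate_inj:
  assumes eq: "\<And>x. x \<in> X \<Longrightarrow> translate k x = translate l x" and i: "i < d"
  shows "k i = l i"
proof -
  have "toeplitz (int (p i)) m (layer (translate j (point (\<lambda>_. 0))) i) (j i)" for j m
    using point_residue[OF i, of m "\<lambda>_. 0"] i
    by (simp add: translate_def layer_stack_fun toeplitz_translate)
  from toeplitz_integer_residue_unique[OF int_p_ge[OF i] this[of _ k] this[of _ l, folded eq[OF point_in_X]]]
  show ?thesis .
qed

lemma Aut_X: "Aut X \<cong> int_power_group d"
proof -
  define h where "h = (\<lambda>k. restrict (translate k) X)"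
  have gr: "group (int_power_group d)" by (simp add: int_power_group_def)
  have car: "carrier (int_power_group d) = ({..<d} \<rightarrow>\<^sub>E UNIV)"
    by (simp add: int_power_group_def)
  have "h \<in> iso (int_power_group d) (Aut X)"
  proof (rule isoI)
    show "h \<in> hom (int_power_group d) (Aut X)"
    proof (rule homI)
      fix k l
      show "h k \<in> carrier (Aut X)" by (simp add: h_def Aut_def translate_automorphism)
      have B: "h k \<in> Bij X" for k using translate_automorphism shift_auts_Bij by (auto simp: h_def)
      have "h (k \<otimes>\<^bsub>int_power_group d\<^esub> l) = compose X (h k) (h l)"
      proof
        fix x
        have "translate (k \<otimes>\<^bsub>int_power_group d\<^esub> l) x = translate (\<lambda>i. k i + l i) x"
          by (rule translate_cong) (simp add: int_power_group_def)
        then show "h (k \<otimes>\<^bsub>int_power_group d\<^esub> l) x = compose X (h k) (h l) x"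
          by (simp add: h_def compose_def translate_translate translate_in_X)
      qed
      then show "h (k \<otimes>\<^bsub>int_power_group d\<^esub> l) = h k \<otimes>\<^bsub>Aut X\<^esub> h l"
        using B by (simp add: Aut_def BijGroup_def)
    qed
    show "bij_betw h (carrier (int_power_group d)) (carrier (Aut X))"
    proof (rule bij_betw_imageI)
      show "inj_on h (carrier (int_power_group d))"
      proof (rule inj_onI)
        fix k l assume kl: "k \<in> carrier (int_power_group d)" "l \<in> carrier (int_power_group d)"
          and eq: "h k = h l"
        have "translate k x = translate l x" if "x \<in> X" for x
          using that fun_cong[OF eq, of x] by (simp add: h_def)
        then have "k i = l i" if "i < d" for i using translate_inj that by blast
        then show "k = l" using kl unfolding car by (intro PiE_ext) auto
      qed
      show "h ` carrier (int_power_group d) = carrier (Aut X)"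
      proof (intro equalityI subsetI)
        fix f assume "f \<in> carrier (Aut X)"
        then have f: "f \<in> shift_auts X" by (simp add: Aut_def)
        then obtain k where k: "\<And>x. x \<in> X \<Longrightarrow> f x = translate k x"
          using automorphism_is_translate by blast
        \<comment> \<open>Elements of the product group are extensional, while
          \<open>translate\<close> reads \<open>k\<close> only below \<open>d\<close>; restricting
          changes nothing in the map.\<close>
        have "f = h (restrict k {..<d})"
        proof
          fix x
          have "translate (restrict k {..<d}) x = translate k x" by (rule translate_cong) simp
          moreover have "f x = undefined" if "x \<notin> X"
            using f that by (auto simp: shift_auts_def extensional_def)
          ultimately show "f x = h (restrict k {..<d}) x" using k by (simp add: h_def)
        qed
        moreover have "restrict k {..<d} \<in> carrier (int_power_group d)" by (simp add: car)
        ultimately show "f \<in> h ` carrier (int_power_group d)" by blast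
      qed (auto simp: h_def Aut_def translate_automorphism)
    qed
  qed
  then show ?thesis using group.iso_sym[OF gr] by (auto simp: is_iso_def)
qed

end

theorem proposition6p2:
  fixes d :: nat
  assumes "d \<ge> 1"
  shows "\<exists>(A :: nat set) X. subshift A X \<and> minimal_shift X \<and>
           (\<lambda>n. real (complexity X n)) \<in> \<Theta>(\<lambda>n. real n ^ d) \<and>
           Aut X \<cong> int_power_group d"
proof -
  \<comment> \<open>The first \<open>d\<close> primes serve as the pairwise coprime bases.\<close>
  let ?p = "enumerate {p :: nat. prime p}"
  have prime: "prime (?p i)" for i using enumerate_in_set[OF primes_infinite] by blast
  have inj: "?p i \<noteq> ?p j" if "i \<noteq> j" for i j
    using strict_mono_enumerate[OF primes_infinite] that by (simp add: strict_mono_eq)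
  interpret toeplitz_product d ?p
    by unfold_locales (auto intro: prime_ge_2_nat[OF prime] primes_coprime[OF prime prime inj])
  show ?thesis using subshift_X minimal_shift_X complexity_X Aut_X by blast
qed

end
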